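(* Consider a network with induced edge set $\mathcal L$ and maps $\mathcal D$, $\mathcal Y$, $\mathcal G(z,d)=(\mathcal Y(d),\mathcal D(z))$ as described in the context. Let $L\subset\mathcal L$ be any cut, i.e. a set of edges such that the graph induced by flows has no directed cycle once the edges of $L$ are removed, and let $\mathcal F^L$ be the corresponding FPTFA map. Let $\mathrm{Low}(\mathcal G)=\{(z,d)\ge0:(z,d)\le\mathcal G(z,d)\}$ and $\mathrm{Low}(\mathcal F^L)=\{z_L\ge 0: z_L\le \mathcal F^L(z_L)\}$. Then: 1. $\mathrm{Low}(\mathcal G)$ is bounded if and only if $\mathrm{Low}(\mathcal F^L)$ is bounded. 2. If $\mathrm{Low}(\mathcal G)$ and $\mathrm{Low}(\mathcal F^L)$ are bounded, then (a) $\mathcal G$ has a unique fixpoint $(\bar z,\bar d)$ and $\mathcal F^L$ has a unique fixpoint $z_L^*$; (b) letting $d^*$ be the collection of delay-jitter bounds computed by FPTFA (the vector $d$ obtained in the FPTFA pass with input $z_L^*$), one has $\bar z_L=z^*_L$ and $\bar d=d^*$.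
   Context: **Network.** There is a finite set $\mathcal I$ of $n$ nodes (output ports) and a finite set of flows. Each flow $f$ has a rate $r_f>0$, a source burstiness $b_f>0$, and a path, i.e. a finite sequence of distinct nodes. A flow is fresh at the first node of its path. The graph induced by flows has vertex set $\mathcal I$ and an edge $(i,j)$ whenever some flow visits $j$ immediately after $i$; such a flow is said to be carried by $(i,j)$. Let $\mathcal L$ be the set of these edges (transit edges); the graph may contain cycles. $\mathrm{In}(i)$ and $\mathrm{Out}(i)$ are the sets of edges of $\mathcal L$ entering, respectively leaving, node $i$ (always in the original, uncut graph). For an edge $\ell=(i,j)$ carried by flow $f$, $\mathrm{Pred}_f(\ell)$ is the set of nodes on the path of $f$ up to and including $i$. **Variables.** $z=(z_{\ell,f})$ is a nonnegative real vector indexed by pairs ($\ell\in\mathcal L$, $f$ carried by $\ell$); $d=(d_i^f)$ is a nonnegative real vector indexed by pairs ($i\in\mathcal I$, $f$ a flow whose path contains $i$). For $M\subset\mathcal L$, $z_M$ is the subvector of entries with $\ell\in M$. All comparisons are coordinatewise. Fixpoints are finite. **Maps.** $\mathcal D(z)=(\mathcal D_i(z_{\mathrm{In}(i)}))_{i\in\mathcal I}$, where $\mathcal D_i$ is the network-calculus delay-jitter bound at node $i$. Each coordinate of $\mathcal D_i$ is finite-valued and is a minimum of finitely many affine functions of its argument (hence concave and continuous), $\mathcal D_i$ is isotonic (coordinatewise nondecreasing), and $\mathcal D(0)>0$ in every coordinate. The map $\mathcal Y$ is $\mathcal Y(d)_{\ell,f}=b_f+r_f\sum_{u\in \mathrm{Pred}_f(\ell)}d_u^f$.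 Set $\mathcal G(z,d)=(\mathcal Y(d),\mathcal D(z))$, acting on nonnegative vectors. For a node $i$, $\mathcal Z_i(d_i,z_{\mathrm{In}(i)})$ is the vector of output burstinesses at $i$: for $\ell\in\mathrm{Out}(i)$ and $f$ carried by $\ell$, its $(\ell,f)$ entry is $b_f+r_fd_i^f$ if $f$ is fresh at $i$, and $z_{\ell'',f}+r_fd_i^f$ otherwise, where $\ell''\in\mathrm{In}(i)$ is the edge by which $f$ enters $i$. **FPTFA pass and $\mathcal F^L$.** Given a cut $L$, label the nodes $i_1,\dots,i_n$ so that $\mathrm{In}(i_1)\subset L$ and $\mathrm{In}(i_k)\subset L\cup\mathrm{Out}(i_1)\cup\dots\cup\mathrm{Out}(i_{k-1})$ for $k\ge2$. Given input $z_L\ge0$, for $k=1,\dots,n$ successively set $d_{i_k}=\mathcal D_{i_k}(z_{\mathrm{In}(i_k)})$; for $\ell\in\mathrm{Out}(i_k)\setminus L$, set $z_\ell$ to be the $\ell$-component of $\mathcal Z_{i_k}(d_{i_k},z_{\mathrm{In}(i_k)})$; for $\ell\in\mathrm{Out}(i_k)\cap L$, set $z'_\ell$ to be the $\ell$-component of $\mathcal Z_{i_k}(d_{i_k},z_{\mathrm{In}(i_k)})$ (leaving the input $z_\ell$ unchanged). Then $\mathcal F^L(z_L)=z'_L$, and $d=(d_i)_{i\in\mathcal I}$ is the vector of delay-jitters obtained in the pass. FPTFA iterates $\mathcal F^L$ starting from $z_L=0$. *)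

theory Defs
  imports Complex_Main "HOL-Library.FuncSet" "HOL-Library.Product_Order"
begin

text \<open>
  The delay-jitter bound of node \<open>i\<close> is the field \<open>jitter\<close>: \<open>jitter N i x f\<close> is the bound for
  flow \<open>f\<close> when \<open>x\<close> is the vector of burstinesses on the edges entering \<open>i\<close>. It is left abstract;
  the locale \<open>network\<close> below states what is assumed of it.
\<close>

record ('v, 'f) net =
  nodes :: "'v set"
  flows :: "'f set"
  route :: "'f \<Rightarrow> 'v list"
  rate :: "'f \<Rightarrow> real"
  burst :: "'f \<Rightarrow> real"
  jitter :: "'v \<Rightarrow> (('v \<times> 'v) \<times> 'f \<Rightarrow> real) \<Rightarrow> 'f \<Rightarrow> real"

definition carries :: "('v, 'f) net \<Rightarrow> 'v \<times> 'v \<Rightarrow> 'f \<Rightarrow> bool" where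
  "carries N l f \<longleftrightarrow> f \<in> flows N \<and>
     (\<exists>k. Suc k < length (route N f) \<and> l = (route N f ! k, route N f ! Suc k))"

definition edges :: "('v, 'f) net \<Rightarrow> ('v \<times> 'v) set" where
  "edges N = {l. \<exists>f. carries N l f}"

definition in_edges :: "('v, 'f) net \<Rightarrow> 'v \<Rightarrow> ('v \<times> 'v) set" where
  "in_edges N i = {l \<in> edges N. snd l = i}"

definition out_edges :: "('v, 'f) net \<Rightarrow> 'v \<Rightarrow> ('v \<times> 'v) set" where
  "out_edges N i = {l \<in> edges N. fst l = i}"

definition preds :: "('v, 'f) net \<Rightarrow> 'f \<Rightarrow> 'v \<times> 'v \<Rightarrow> 'v set" where
  "preds N f l = {route N f ! m | m k. m \<le> k \<and> k < length (route N f) \<and> route N f ! k = fst l}"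

definition fresh :: "('v, 'f) net \<Rightarrow> 'f \<Rightarrow> 'v \<Rightarrow> bool" where
  "fresh N f i \<longleftrightarrow> i = hd (route N f)"

text \<open>Unique when \<open>f\<close> visits \<open>i\<close> and is not fresh there, since routes have distinct nodes.\<close>

definition entry_edge :: "('v, 'f) net \<Rightarrow> 'f \<Rightarrow> 'v \<Rightarrow> 'v \<times> 'v" where
  "entry_edge N f i = (THE l. l \<in> in_edges N i \<and> carries N l f)"

text \<open>
  A vector with finite index set \<open>A\<close> is a function that is \<^term>\<open>undefined\<close> outside \<open>A\<close>. Hence
  equality of vectors, and the pointwise order on functions, are the coordinatewise ones on \<open>A\<close>;
  the subvector of \<open>x\<close> with index set \<open>B\<close> is \<^term>\<open>restrict x B\<close>. Pairs of vectors are ordered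
  componentwise.
\<close>

definition nnvec :: "'a set \<Rightarrow> ('a \<Rightarrow> real) set" where
  "nnvec A = A \<rightarrow>\<^sub>E {0..}"

definition vec_bounded :: "'a set \<Rightarrow> ('a \<Rightarrow> real) set \<Rightarrow> bool" where
  "vec_bounded A S \<longleftrightarrow> (\<exists>B. \<forall>x\<in>S. \<forall>a\<in>A. \<bar>x a\<bar> \<le> B)"

definition pair_bounded :: "'a set \<Rightarrow> 'b set \<Rightarrow> (('a \<Rightarrow> real) \<times> ('b \<Rightarrow> real)) set \<Rightarrow> bool" where
  "pair_bounded A B S \<longleftrightarrow> vec_bounded A (fst ` S) \<and> vec_bounded B (snd ` S)"

definition Low :: "'a::ord set \<Rightarrow> ('a \<Rightarrow> 'a) \<Rightarrow> 'a set" where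
  "Low X g = {x \<in> X. x \<le> g x}"

definition zidx :: "('v, 'f) net \<Rightarrow> ('v \<times> 'v) set \<Rightarrow> (('v \<times> 'v) \<times> 'f) set" where
  "zidx N M = {(l, f). l \<in> M \<and> carries N l f}"

definition didx :: "('v, 'f) net \<Rightarrow> ('v \<times> 'f) set" where
  "didx N = {(i, f). f \<in> flows N \<and> i \<in> set (route N f)}"

locale network =
  fixes N :: "('v, 'f) net"
  assumes finite_nodes: "finite (nodes N)"
    and finite_flows: "finite (flows N)"
    and route_nodes: "f \<in> flows N \<Longrightarrow> set (route N f) \<subseteq> nodes N"
    and route_nonempty: "f \<in> flows N \<Longrightarrow> route N f \<noteq> []"
    and route_distinct: "f \<in> flows N \<Longrightarrow> distinct (route N f)"
    and rate_pos: "f \<in> flows N \<Longrightarrow> 0 < rate N f"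
    and burst_pos: "f \<in> flows N \<Longrightarrow> 0 < burst N f"
    and jitter_min_affine: "(i, f) \<in> didx N \<Longrightarrow>
      \<exists>K :: (real \<times> (('v \<times> 'v) \<times> 'f \<Rightarrow> real)) set. finite K \<and> K \<noteq> {} \<and>
        (\<forall>x \<in> nnvec (zidx N (in_edges N i)).
           jitter N i x f = Min ((\<lambda>(c, a). c + (\<Sum>p \<in> zidx N (in_edges N i). a p * x p)) ` K))"
    and jitter_isotonic: "(i, f) \<in> didx N \<Longrightarrow>
      mono_on (nnvec (zidx N (in_edges N i))) (\<lambda>x. jitter N i x f)"
    and jitter_zero_pos: "(i, f) \<in> didx N \<Longrightarrow>
      0 < jitter N i (\<lambda>p \<in> zidx N (in_edges N i). 0) f"

definition Dmap :: "('v, 'f) net \<Rightarrow> (('v \<times> 'v) \<times> 'f \<Rightarrow> real) \<Rightarrow> 'v \<times> 'f \<Rightarrow> real" where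
  "Dmap N z = (\<lambda>(i, f) \<in> didx N. jitter N i (restrict z (zidx N (in_edges N i))) f)"

definition Ymap :: "('v, 'f) net \<Rightarrow> ('v \<times> 'f \<Rightarrow> real) \<Rightarrow> ('v \<times> 'v) \<times> 'f \<Rightarrow> real" where
  "Ymap N d = (\<lambda>(l, f) \<in> zidx N (edges N). burst N f + rate N f * (\<Sum>u \<in> preds N f l. d (u, f)))"

definition Gmap :: "('v, 'f) net \<Rightarrow>
    (('v \<times> 'v) \<times> 'f \<Rightarrow> real) \<times> ('v \<times> 'f \<Rightarrow> real) \<Rightarrow>
    (('v \<times> 'v) \<times> 'f \<Rightarrow> real) \<times> ('v \<times> 'f \<Rightarrow> real)" where
  "Gmap N = (\<lambda>(z, d). (Ymap N d, Dmap N z))"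

definition Gdom :: "('v, 'f) net \<Rightarrow> ((('v \<times> 'v) \<times> 'f \<Rightarrow> real) \<times> ('v \<times> 'f \<Rightarrow> real)) set" where
  "Gdom N = nnvec (zidx N (edges N)) \<times> nnvec (didx N)"

definition is_cut :: "('v, 'f) net \<Rightarrow> ('v \<times> 'v) set \<Rightarrow> bool" where
  "is_cut N L \<longleftrightarrow> L \<subseteq> edges N \<and> acyclic (edges N - L)"

definition fptfa_order :: "('v, 'f) net \<Rightarrow> ('v \<times> 'v) set \<Rightarrow> 'v list \<Rightarrow> bool" where
  "fptfa_order N L vs \<longleftrightarrow> distinct vs \<and> set vs = nodes N \<and>
     (\<forall>k < length vs. in_edges N (vs ! k) \<subseteq> L \<union> (\<Union>m<k. out_edges N (vs ! m)))"

definition Zmap :: "('v, 'f) net \<Rightarrow> 'v \<Rightarrow> ('f \<Rightarrow> real) \<Rightarrow> (('v \<times> 'v) \<times> 'f \<Rightarrow> real) \<Rightarrow>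
    ('v \<times> 'v) \<times> 'f \<Rightarrow> real" where
  "Zmap N i \<delta> x = (\<lambda>(l, f) \<in> zidx N (out_edges N i).
     (if fresh N f i then burst N f else x (entry_edge N f i, f)) + rate N f * \<delta> f)"

text \<open>
  The state of a pass is \<open>(z, z', d)\<close>: current burstinesses (the input on \<open>L\<close>, computed values
  elsewhere), output burstinesses on \<open>L\<close>, and delay-jitters. Entries not yet computed are
  \<^term>\<open>undefined\<close>.
\<close>

definition fptfa_step :: "('v, 'f) net \<Rightarrow> ('v \<times> 'v) set \<Rightarrow> 'v \<Rightarrow>
    (('v \<times> 'v) \<times> 'f \<Rightarrow> real) \<times> (('v \<times> 'v) \<times> 'f \<Rightarrow> real) \<times> ('v \<times> 'f \<Rightarrow> real) \<Rightarrow>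
    (('v \<times> 'v) \<times> 'f \<Rightarrow> real) \<times> (('v \<times> 'v) \<times> 'f \<Rightarrow> real) \<times> ('v \<times> 'f \<Rightarrow> real)" where
  "fptfa_step N L i = (\<lambda>(z, z', d).
     let x = restrict z (zidx N (in_edges N i));
         \<delta> = jitter N i x;
         y = Zmap N i \<delta> x
     in (override_on z y (zidx N (out_edges N i - L)),
         override_on z' y (zidx N (out_edges N i \<inter> L)),
         override_on d (\<lambda>(j, f). \<delta> f) {(j, f) \<in> didx N. j = i}))"

definition fptfa_pass :: "('v, 'f) net \<Rightarrow> ('v \<times> 'v) set \<Rightarrow> 'v list \<Rightarrow> (('v \<times> 'v) \<times> 'f \<Rightarrow> real) \<Rightarrow>
    (('v \<times> 'v) \<times> 'f \<Rightarrow> real) \<times> (('v \<times> 'v) \<times> 'f \<Rightarrow> real) \<times> ('v \<times> 'f \<Rightarrow> real)" where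
  "fptfa_pass N L vs zL = fold (fptfa_step N L) vs (zL, \<lambda>_. undefined, \<lambda>_. undefined)"

definition Fmap :: "('v, 'f) net \<Rightarrow> ('v \<times> 'v) set \<Rightarrow> 'v list \<Rightarrow>
    (('v \<times> 'v) \<times> 'f \<Rightarrow> real) \<Rightarrow> ('v \<times> 'v) \<times> 'f \<Rightarrow> real" where
  "Fmap N L vs zL = fst (snd (fptfa_pass N L vs zL))"

definition fptfa_delays :: "('v, 'f) net \<Rightarrow> ('v \<times> 'v) set \<Rightarrow> 'v list \<Rightarrow>
    (('v \<times> 'v) \<times> 'f \<Rightarrow> real) \<Rightarrow> 'v \<times> 'f \<Rightarrow> real" where
  "fptfa_delays N L vs zL = snd (snd (fptfa_pass N L vs zL))"

text \<open>Thus a claim about all node orders admissible for a cut is never vacuous.\<close>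

lemma acyclic_topological_list:
  assumes "finite A" "finite R" "acyclic R"
  shows "\<exists>vs. distinct vs \<and> set vs = A \<and>
    (\<forall>k < length vs. \<forall>j \<in> A. (j, vs ! k) \<in> R \<longrightarrow> j \<in> set (take k vs))"
  using assms(1)
proof (induction "card A" arbitrary: A)
  case 0
  then show ?case by auto
next
  case (Suc c)
  have "wf (R\<inverse>)" using assms(2,3) by (rule finite_acyclic_wf_converse)
  moreover obtain a where "a \<in> A" using Suc.hyps(2) by fastforce
  ultimately obtain m where m: "m \<in> A" "\<And>y. (y, m) \<in> R\<inverse> \<Longrightarrow> y \<notin> A"
    by (rule wfE_min) blast
  have "c = card (A - {m})" "finite (A - {m})"
    using card_Diff_singleton[OF m(1)] Suc.hyps(2)[symmetric] Suc.prems by simp_all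
  from Suc.hyps(1)[OF this] obtain vs where vs: "distinct vs" "set vs = A - {m}"
    "\<forall>k < length vs. \<forall>j \<in> A - {m}. (j, vs ! k) \<in> R \<longrightarrow> j \<in> set (take k vs)"
    by (elim exE conjE)
  have "j \<in> set (take k (vs @ [m]))"
    if "k < length (vs @ [m])" "j \<in> A" "(j, (vs @ [m]) ! k) \<in> R" for k j
  proof (cases "k < length vs")
    case True
    then have "vs ! k \<in> A" using vs(2) nth_mem by blast
    then have "j \<noteq> m" using that(3) True m(2) by (auto simp: nth_append)
    then show ?thesis using True that vs(3) by (auto simp: nth_append)
  next
    case False
    then have "k = length vs" using that(1) by simp
    moreover have "m \<noteq> j" using that(3) \<open>k = length vs\<close> assms(3) by (auto simp: acyclic_def)
    ultimately show ?thesis using that(2) vs(2) by auto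
  qed
  moreover have "distinct (vs @ [m])" "set (vs @ [m]) = A" using vs(1,2) m(1) by auto
  ultimately show ?case by blast
qed

lemma (in network) fptfa_order_exists:
  assumes "is_cut N L"
  shows "\<exists>vs. fptfa_order N L vs"
proof -
  have sub: "edges N \<subseteq> nodes N \<times> nodes N"
  proof
    fix l assume "l \<in> edges N"
    then obtain f k where *: "f \<in> flows N" "Suc k < length (route N f)"
      "l = (route N f ! k, route N f ! Suc k)"
      by (auto simp: edges_def carries_def)
    have "route N f ! k \<in> set (route N f)" "route N f ! Suc k \<in> set (route N f)"
      using *(2) by simp_all
    then show "l \<in> nodes N \<times> nodes N" using *(3) route_nodes[OF *(1)] by auto
  qed
  have "finite (edges N - L)" using finite_subset[OF sub] finite_nodes by simp
  then obtain vs where vs: "distinct vs" "set vs = nodes N"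
    "\<forall>k < length vs. \<forall>j \<in> nodes N. (j, vs ! k) \<in> edges N - L \<longrightarrow> j \<in> set (take k vs)"
    using acyclic_topological_list[OF finite_nodes, of "edges N - L"] assms
    unfolding is_cut_def by auto
  have "(j, vs ! k) \<in> (\<Union>m<k. out_edges N (vs ! m))"
    if "k < length vs" "(j, vs ! k) \<in> edges N" "(j, vs ! k) \<notin> L" for k j
  proof -
    have "j \<in> set (take k vs)" using vs(3) that sub by auto
    then obtain m where "m < k" "vs ! m = j" by (auto simp: in_set_conv_nth)
    then show ?thesis using that(2) by (auto simp: out_edges_def)
  qed
  then have "l \<in> L \<union> (\<Union>m<k. out_edges N (vs ! m))"
    if "k < length vs" "l \<in> in_edges N (vs ! k)" for k l
    using that by (cases l) (auto simp only: in_edges_def mem_Collect_eq snd_conv Un_iff)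
  then show ?thesis using vs(1,2) unfolding fptfa_order_def by blast
qed

end

theory Submission
  imports Defs
begin

text \<open>
  An FPTFA pass with input \<open>z\<^sub>L\<close> computes the unique vectors with \<open>z = z\<^sub>L\<close> on the cut,
  \<open>d = \<D>(z)\<close>, and output burstiness equal to the upstream burstiness plus \<open>r d\<close> on every edge.
  Comparing sub- and supersolutions along the node order gives uniqueness and isotonicity of the
  pass; telescoping the output equation along a route turns it into \<open>z = \<Y>(d)\<close>. Hence postfixed
  points and fixpoints of \<open>\<F>\<^sup>L\<close> and \<open>\<G>\<close> correspond to each other, and it remains to study
  \<open>\<Y> \<circ> \<D>\<close>: it is isotonic, so a bounded \<open>Low\<close> has a supremum that is a fixpoint, and it
  is strictly subhomogeneous (concavity and \<open>\<D>(0) > 0\<close>, \<open>b > 0\<close>), so the fixpoint is unique.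
\<close>

section \<open>Isotonic strictly subhomogeneous maps\<close>

lemma vec_bounded_upper:
  assumes "finite A" "S \<subseteq> nnvec A" "\<And>x a. x \<in> S \<Longrightarrow> a \<in> A \<Longrightarrow> x a \<le> u a"
  shows "vec_bounded A S"
proof -
  have "\<bar>x a\<bar> \<le> (\<Sum>a\<in>A. \<bar>u a\<bar>)" if "x \<in> S" "a \<in> A" for x a
  proof -
    have "0 \<le> x a" using that assms(2) by (auto simp: nnvec_def)
    then have "\<bar>x a\<bar> \<le> \<bar>u a\<bar>" using assms(3)[OF that] by linarith
    also have "\<dots> \<le> (\<Sum>a\<in>A. \<bar>u a\<bar>)" using assms(1) that by (intro member_le_sum) auto
    finally show ?thesis .
  qed
  then show ?thesis unfolding vec_bounded_def by blast
qed

text \<open>Off \<open>A\<close> both vectors are \<open>undefined\<close>, so the order on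
  functions only sees the coordinates in \<open>A\<close>.\<close>

lemma nnvec_le_iff:
  assumes "x \<in> nnvec A" "y \<in> nnvec A"
  shows "x \<le> y \<longleftrightarrow> (\<forall>a\<in>A. x a \<le> y a)"
proof -
  have "x a = y a" if "a \<notin> A" for a
    using assms that by (simp add: nnvec_def PiE_def extensional_def)
  then show ?thesis unfolding le_fun_def by (metis order_refl)
qed

lemma nnvec_nonneg: "x \<in> nnvec A \<Longrightarrow> a \<in> A \<Longrightarrow> 0 \<le> x a"
  by (auto simp: nnvec_def)

lemma nnvec_restrict: "x \<in> nnvec A \<Longrightarrow> B \<subseteq> A \<Longrightarrow> restrict x B \<in> nnvec B"
  by (auto simp: nnvec_def)

text \<open>Knaster-Tarski with boundedness in place of a complete lattice: the coordinatewise
  supremum of the postfixed points is postfixed, so its image is postfixed as well and hence lies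
  below the supremum.\<close>

lemma bounded_Low_fixpoint:
  fixes H :: "('a \<Rightarrow> real) \<Rightarrow> 'a \<Rightarrow> real"
  assumes maps: "\<And>x. x \<in> nnvec A \<Longrightarrow> H x \<in> nnvec A"
    and mono: "mono_on (nnvec A) H"
    and bdd: "vec_bounded A (Low (nnvec A) H)"
  shows "\<exists>x \<in> nnvec A. H x = x"
proof -
  let ?S = "Low (nnvec A) H"
  define s where "s = (\<lambda>a\<in>A. SUP x\<in>?S. x a)"
  \<comment> \<open>The zero vector is postfixed, so the suprema range over a nonempty set and are
    nonnegative.\<close>
  define o0 :: "'a \<Rightarrow> real" where "o0 = (\<lambda>a\<in>A. 0)"
  obtain B where B: "\<And>x a. x \<in> ?S \<Longrightarrow> a \<in> A \<Longrightarrow> \<bar>x a\<bar> \<le> B"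
    using bdd unfolding vec_bounded_def by blast
  have o0: "o0 \<in> nnvec A" by (auto simp: o0_def nnvec_def)
  then have "o0 \<le> H o0"
    using maps[OF o0] by (auto simp: nnvec_le_iff o0_def nnvec_nonneg)
  then have o0S: "o0 \<in> ?S" using o0 by (simp add: Low_def)
  have up: "x a \<le> s a" if "x \<in> ?S" "a \<in> A" for x a
    unfolding s_def using that B by (auto intro!: cSUP_upper bdd_aboveI2[where M=B] dest: abs_le_D1)
  have least: "s a \<le> c" if "a \<in> A" "\<And>x. x \<in> ?S \<Longrightarrow> x a \<le> c" for a c
    unfolding s_def using that o0S by (auto intro!: cSUP_least)
  have s: "s \<in> nnvec A"
    using up[OF o0S] by (auto simp: nnvec_def o0_def) (auto simp: s_def)
  have le: "s \<le> H s"
  proof (subst nnvec_le_iff[OF s maps[OF s]], intro ballI least)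
    fix a x assume "a \<in> A" "x \<in> ?S"
    then have x: "x \<in> nnvec A" "x \<le> H x" by (auto simp: Low_def)
    have "x \<le> s" using up[OF \<open>x \<in> ?S\<close>] by (simp add: nnvec_le_iff[OF x(1) s])
    then have "H x \<le> H s" using mono x(1) s by (auto dest: mono_onD)
    then show "x a \<le> H s a" using x(2) by (auto simp: le_fun_def intro: order_trans)
  qed
  then have "H s \<le> H (H s)" using mono s maps by (auto dest: mono_onD)
  then have "H s \<in> ?S" using s maps by (simp add: Low_def)
  then have "H s \<le> s" using up by (simp add: nnvec_le_iff[OF maps[OF s] s])
  then show ?thesis using le s by (auto intro: antisym)
qed

text \<open>Shrink \<open>y\<close> by the largest factor \<open>t\<close> that puts it below
  \<open>x\<close>; the two then touch in a coordinate \<open>m\<close>. If \<open>t < 1\<close>,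
  strict subhomogeneity and isotonicity give \<open>t * y m < x m\<close>, a contradiction.
  Exchanging \<open>x\<close> and \<open>y\<close> yields uniqueness.\<close>

lemma subhomogeneous_fixpoint_le:
  fixes H :: "('a \<Rightarrow> real) \<Rightarrow> 'a \<Rightarrow> real"
  assumes fin: "finite A"
    and mono: "mono_on (nnvec A) H"
    and sub: "\<And>x t a. \<lbrakk>x \<in> nnvec A; 0 \<le> t; t < 1; a \<in> A\<rbrakk> \<Longrightarrow> t * H x a < H (\<lambda>a\<in>A. t * x a) a"
    and x: "x \<in> nnvec A" "H x = x" and y: "y \<in> nnvec A" "H y = y"
  shows "y \<le> x"
proof (rule ccontr)
  assume "\<not> y \<le> x"
  then obtain c where c: "c \<in> A" "x c < y c"
    unfolding nnvec_le_iff[OF y(1) x(1)] by (auto simp: not_le)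
  have scale: "(\<lambda>a\<in>A. t * y a) \<in> nnvec A" if "0 \<le> t" for t
    using that nnvec_nonneg[OF y(1)] by (simp add: nnvec_def PiE_iff)
  \<comment> \<open>Taking \<open>t = 0\<close> in \<open>sub\<close> shows that the image of the
    zero vector is positive, and it lies below \<open>H y = y\<close>. Division by \<open>y\<close>
    is thus meaningful.\<close>
  have pos: "0 < y a" if "a \<in> A" for a
  proof -
    have "(\<lambda>a\<in>A. 0 * y a) \<le> y"
      using nnvec_le_iff[OF scale[of 0] y(1)] nnvec_nonneg[OF y(1)] by auto
    then have "H (\<lambda>a\<in>A. 0 * y a) \<le> y" using mono_onD[OF mono scale[of 0] y(1)] y(2) by simp
    then show ?thesis using sub[OF y(1), of 0 a] that by (auto simp: le_fun_def intro: less_le_trans)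
  qed
  \<comment> \<open>The largest factor with \<open>t * y\<close> below \<open>x\<close>, attained
    where the two agree.\<close>
  define t where "t = Min ((\<lambda>a. x a / y a) ` A)"
  have "t \<in> (\<lambda>a. x a / y a) ` A" unfolding t_def using fin c(1) by (intro Min_in) auto
  then obtain m where m: "m \<in> A" "t = x m / y m" by blast
  have tle: "t \<le> x a / y a" if "a \<in> A" for a unfolding t_def using fin that by simp
  have "x c / y c < 1" using c pos by simp
  then have t: "t < 1" using tle[OF c(1)] by simp
  have t0: "0 \<le> t"
    unfolding m(2) using nnvec_nonneg[OF x(1) m(1)] pos[OF m(1)] by simp
  have "(\<lambda>a\<in>A. t * y a) \<le> x"
    using tle pos by (subst nnvec_le_iff[OF scale[OF t0] x(1)]) (auto simp: pos_le_divide_eq)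
  then have "H (\<lambda>a\<in>A. t * y a) m \<le> x m"
    using mono_onD[OF mono scale[OF t0] x(1)] x(2) by (simp add: le_fun_def)
  then have "t * y m < x m" using sub[OF y(1) t0 t m(1)] y(2) by simp
  then show False using m pos[OF m(1)] by simp
qed

section \<open>Edges along a route\<close>

lemma zidx_iff: "(l, f) \<in> zidx N M \<longleftrightarrow> l \<in> M \<and> carries N l f"
  by (simp add: zidx_def)

lemma zidx_mono: "M \<subseteq> M' \<Longrightarrow> zidx N M \<subseteq> zidx N M'"
  by (auto simp: zidx_def)

text \<open>Burstiness with which \<open>f\<close> arrives at the tail of \<open>l\<close>: the term
  to which \<open>Zmap\<close> adds rate times delay. It reads from a vector on all edges, so that
  the pass and \<open>Ymap\<close> obey the same recursion.\<close>

definition upstream :: "('v, 'f) net \<Rightarrow> (('v \<times> 'v) \<times> 'f \<Rightarrow> real) \<Rightarrow> ('v \<times> 'v) \<Rightarrow> 'f \<Rightarrow> real" where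
  "upstream N z l f = (if fresh N f (fst l) then burst N f else z (entry_edge N f (fst l), f))"

context network
begin

lemma carries_edge: "carries N l f \<Longrightarrow> l \<in> edges N"
  by (auto simp: edges_def)

lemma carries_nth:
  "f \<in> flows N \<Longrightarrow> Suc k < length (route N f) \<Longrightarrow>
    carries N (route N f ! k, route N f ! Suc k) f"
  unfolding carries_def by blast

lemma carries_didx: "carries N l f \<Longrightarrow> (fst l, f) \<in> didx N"
  by (auto simp: carries_def didx_def)

lemma carries_node: "carries N l f \<Longrightarrow> fst l \<in> nodes N"
  using route_nodes by (fastforce simp: carries_def)

lemma finite_didx: "finite (didx N)"
proof (rule finite_subset)
  show "didx N \<subseteq> nodes N \<times> flows N" using route_nodes by (auto simp: didx_def)
qed (simp add: finite_nodes finite_flows)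

lemma finite_zidx: "finite (zidx N M)"
proof (rule finite_subset)
  show "zidx N M \<subseteq> (nodes N \<times> nodes N) \<times> flows N"
    using route_nodes nth_mem by (fastforce simp: zidx_def carries_def)
qed (simp add: finite_nodes finite_flows)

text \<open>Routes have distinct nodes, so the tail of an edge has a single position and its
  predecessors form a prefix of the route.\<close>

lemma preds_nth:
  assumes "f \<in> flows N" "k < length (route N f)"
  shows "preds N f (route N f ! k, j) = (\<lambda>m. route N f ! m) ` {..k}"
  using assms route_distinct[OF assms(1)]
  by (auto simp: preds_def nth_eq_iff_index_eq)

lemma fresh_nth:
  assumes "f \<in> flows N" "k < length (route N f)"
  shows "fresh N f (route N f ! k) \<longleftrightarrow> k = 0"
  using assms route_distinct[OF assms(1)] route_nonempty[OF assms(1)]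
  by (simp add: fresh_def hd_conv_nth nth_eq_iff_index_eq)

lemma entry_edge_nth:
  assumes "f \<in> flows N" "Suc k < length (route N f)"
  shows "entry_edge N f (route N f ! Suc k) = (route N f ! k, route N f ! Suc k)"
  unfolding entry_edge_def
proof (rule the_equality)
  show "(route N f ! k, route N f ! Suc k) \<in> in_edges N (route N f ! Suc k) \<and>
      carries N (route N f ! k, route N f ! Suc k) f"
    using assms by (auto simp: in_edges_def edges_def carries_def)
next
  fix l assume "l \<in> in_edges N (route N f ! Suc k) \<and> carries N l f"
  then show "l = (route N f ! k, route N f ! Suc k)"
    using assms route_distinct[OF assms(1)]
    by (auto simp: in_edges_def carries_def nth_eq_iff_index_eq)
qed

lemma entry_edge_carries:
  assumes "carries N l f" "\<not> fresh N f (fst l)"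
  shows "entry_edge N f (fst l) \<in> in_edges N (fst l)" "carries N (entry_edge N f (fst l)) f"
proof -
  obtain k where k: "f \<in> flows N" "Suc k < length (route N f)"
    "l = (route N f ! k, route N f ! Suc k)"
    using assms(1) by (auto simp: carries_def)
  then obtain j where j: "k = Suc j" using assms(2) fresh_nth[of f k] by (cases k) (auto dest: Suc_lessD)
  have "entry_edge N f (fst l) = (route N f ! j, route N f ! Suc j)"
    using k j entry_edge_nth[of f j] by simp
  then show "entry_edge N f (fst l) \<in> in_edges N (fst l)" "carries N (entry_edge N f (fst l)) f"
    using k j carries_nth[OF k(1), of j] by (auto simp: in_edges_def carries_edge)
qed

text \<open>Induction on the position of the edge in the route. It follows a single flow, so it
  applies even when the graph of the whole network has cycles.\<close>

lemma route_induct [consumes 1, case_names fresh step]: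
  assumes "carries N l f"
    and "\<And>l. carries N l f \<Longrightarrow> fresh N f (fst l) \<Longrightarrow> P l"
    and "\<And>l. carries N l f \<Longrightarrow> \<not> fresh N f (fst l) \<Longrightarrow> P (entry_edge N f (fst l)) \<Longrightarrow> P l"
  shows "P l"
proof -
  have "P (route N f ! k, route N f ! Suc k)" if "f \<in> flows N" "Suc k < length (route N f)" for k
    using that(2)
  proof (induction k)
    case 0
    then show ?case using that(1) fresh_nth[OF that(1), of 0] route_nonempty[OF that(1)] by (intro assms(2)) (auto simp: carries_def)
  next
    case (Suc k)
    have "\<not> fresh N f (route N f ! Suc k)" using fresh_nth[OF that(1), of "Suc k"] Suc.prems by simp
    moreover have "P (route N f ! k, route N f ! Suc k)" using Suc by simp
    ultimately show ?case
      using carries_nth[OF that(1) Suc.prems] entry_edge_nth[OF that(1), of k] Suc.prems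
      by - (rule assms(3), simp_all)
  qed
  then show ?thesis using assms(1) by (auto simp: carries_def)
qed

lemma upstream_mono:
  assumes "carries N l f" "\<And>p. p \<in> zidx N (edges N) \<Longrightarrow> z p \<le> w p"
  shows "upstream N z l f \<le> upstream N w l f"
  using assms(2)[of "(entry_edge N f (fst l), f)"] entry_edge_carries(2)[OF assms(1)]
  by (auto simp: upstream_def zidx_iff carries_edge)

text \<open>Telescoping: prefix sums at consecutive positions differ by the delay at the tail of
  \<open>l\<close>. Thus \<open>Ymap\<close> solves the output recursion of the pass with
  \<open>d\<close> held fixed.\<close>

lemma Ymap_upstream:
  assumes "carries N l f"
  shows "Ymap N d (l, f) = upstream N (Ymap N d) l f + rate N f * d (fst l, f)"
proof -
  obtain k where k: "f \<in> flows N" "Suc k < length (route N f)"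
    "l = (route N f ! k, route N f ! Suc k)"
    using assms by (auto simp: carries_def)
  \<comment> \<open>Distinct nodes let the sum over predecessors be reindexed by positions.\<close>
  have Y: "Ymap N d ((route N f ! m, route N f ! Suc m), f) =
      burst N f + rate N f * (\<Sum>j\<le>m. d (route N f ! j, f))" if "m \<le> k" for m
  proof -
    have m: "Suc m < length (route N f)" using that k(2) by simp
    have "inj_on (\<lambda>j. route N f ! j) {..m}"
      using m route_distinct[OF k(1)] by (auto intro!: inj_on_nth)
    moreover note carries_nth[OF k(1) m]
    ultimately show ?thesis
      using that k by (simp add: Ymap_def zidx_def carries_edge preds_nth sum.reindex)
  qed
  show ?thesis
  proof (cases k)
    case 0
    then show ?thesis using k Y[of 0] fresh_nth[of f 0] route_nonempty[OF k(1)] by (simp add: upstream_def)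
  next
    case (Suc j)
    then show ?thesis
      using k Y[of k] Y[of j] fresh_nth[of f k] entry_edge_nth[of f j]
      by (simp add: upstream_def algebra_simps)
  qed
qed

text \<open>With \<open>d\<close> fixed, the recursion runs along one route, so a subsolution stays
  below a supersolution from the first edge on. \<open>Ymap N d\<close> is an exact solution and can
  take either role.\<close>

lemma upstream_compare:
  assumes "carries N l f"
    and "\<And>l. carries N l f \<Longrightarrow> z (l, f) \<le> upstream N z l f + rate N f * d (fst l, f)"
    and "\<And>l. carries N l f \<Longrightarrow> upstream N w l f + rate N f * d (fst l, f) \<le> w (l, f)"
  shows "z (l, f) \<le> w (l, f)"
  using assms(1)
proof (induction rule: route_induct)
  case (fresh l)
  then show ?case using assms(2,3)[of l] by (simp add: upstream_def)
next
  case (step l)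
  then show ?case using assms(2,3)[of l] by (simp add: upstream_def)
qed

section \<open>The maps \<open>\<D>\<close> and \<open>\<Y>\<close>\<close>

lemma in_edges_subset: "zidx N (in_edges N i) \<subseteq> zidx N (edges N)"
  by (auto simp: zidx_def in_edges_def)

lemma jitter_mono:
  assumes "(i, f) \<in> didx N" "x \<in> nnvec (zidx N (in_edges N i))" "y \<in> nnvec (zidx N (in_edges N i))"
    "\<And>p. p \<in> zidx N (in_edges N i) \<Longrightarrow> x p \<le> y p"
  shows "jitter N i x f \<le> jitter N i y f"
  using mono_onD[OF jitter_isotonic[OF assms(1)] assms(2,3)] assms(4)
  by (simp add: nnvec_le_iff[OF assms(2,3)])

lemma jitter_pos:
  assumes "(i, f) \<in> didx N" "x \<in> nnvec (zidx N (in_edges N i))"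
  shows "0 < jitter N i x f"
proof -
  have "jitter N i (\<lambda>p \<in> zidx N (in_edges N i). 0) f \<le> jitter N i x f"
    using assms by (intro jitter_mono) (auto simp: nnvec_def)
  then show ?thesis using jitter_zero_pos[OF assms(1)] by simp
qed

text \<open>Let an affine piece with constant \<open>c\<close> attain the minimum at
  \<open>t * x\<close>. Its value there is \<open>t\<close> times its value at \<open>x\<close> plus
  \<open>(1 - t) * c\<close>; the value at \<open>x\<close> is at least the jitter there, and
  \<open>c > 0\<close>.\<close>

lemma jitter_subhomogeneous:
  assumes i: "(i, f) \<in> didx N" and x: "x \<in> nnvec (zidx N (in_edges N i))" and t: "0 \<le> t" "t < 1"
  shows "t * jitter N i x f < jitter N i (\<lambda>p \<in> zidx N (in_edges N i). t * x p) f"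
proof -
  let ?I = "zidx N (in_edges N i)"
  obtain K :: "(real \<times> (('v \<times> 'v) \<times> 'f \<Rightarrow> real)) set" where K: "finite K" "K \<noteq> {}"
    "\<And>x. x \<in> nnvec ?I \<Longrightarrow>
      jitter N i x f = Min ((\<lambda>(c, a). c + (\<Sum>p \<in> ?I. a p * x p)) ` K)"
    using jitter_min_affine[OF i] by blast
  let ?m = "\<lambda>x (c, a). c + (\<Sum>p \<in> ?I. a p * x p)"
  have le: "jitter N i x f \<le> ?m x k" if "x \<in> nnvec ?I" "k \<in> K" for x k
    using K that by simp
  have tx: "(\<lambda>p\<in>?I. t * x p) \<in> nnvec ?I"
    using nnvec_nonneg[OF x] t by (simp add: nnvec_def PiE_iff)
  have o: "(\<lambda>p\<in>?I. 0) \<in> nnvec ?I" by (auto simp: nnvec_def)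
  have "jitter N i (\<lambda>p\<in>?I. t * x p) f \<in> ?m (\<lambda>p\<in>?I. t * x p) ` K"
    unfolding K(3)[OF tx] using K(1,2) by (intro Min_in) auto
  then obtain c a where ca: "(c, a) \<in> K"
    "jitter N i (\<lambda>p\<in>?I. t * x p) f = c + (\<Sum>p \<in> ?I. a p * (t * x p))" by auto
  \<comment> \<open>At the zero vector the piece takes the value \<open>c\<close>, which is at least
    the jitter there.\<close>
  have "0 < c" using le[OF o ca(1)] jitter_zero_pos[OF i] by simp
  then have "0 < (1 - t) * c" using t by simp
  moreover have "t * jitter N i x f \<le> t * (c + (\<Sum>p \<in> ?I. a p * x p))"
    using le[OF x ca(1)] t(1) by (simp add: mult_left_mono)
  ultimately show ?thesis unfolding ca(2)
    by (simp add: algebra_simps sum_distrib_left)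
qed

lemma Dmap_eq: "(i, f) \<in> didx N \<Longrightarrow>
    Dmap N z (i, f) = jitter N i (restrict z (zidx N (in_edges N i))) f"
  by (simp add: Dmap_def)

lemma Dmap_pos:
  assumes "z \<in> nnvec (zidx N (edges N))" "p \<in> didx N"
  shows "0 < Dmap N z p"
  using assms jitter_pos nnvec_restrict[OF assms(1) in_edges_subset]
  by (cases p) (simp add: Dmap_eq)

lemma Dmap_nnvec:
  assumes "z \<in> nnvec (zidx N (edges N))"
  shows "Dmap N z \<in> nnvec (didx N)"
proof -
  have "Dmap N z \<in> extensional (didx N)" by (simp add: Dmap_def)
  then show ?thesis using Dmap_pos[OF assms] by (auto simp: nnvec_def PiE_def intro: less_imp_le)
qed

text \<open>Only edges entering \<open>i\<close> are compared: these are the ones an induction along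
  a node order has already covered.\<close>

lemma Dmap_mono:
  assumes "z \<in> nnvec (zidx N (edges N))" "w \<in> nnvec (zidx N (edges N))"
    and "(i, f) \<in> didx N" "\<And>p. p \<in> zidx N (in_edges N i) \<Longrightarrow> z p \<le> w p"
  shows "Dmap N z (i, f) \<le> Dmap N w (i, f)"
  using assms nnvec_restrict[OF _ in_edges_subset] by (auto simp: Dmap_eq intro!: jitter_mono)

lemma Dmap_subhomogeneous:
  assumes z: "z \<in> nnvec (zidx N (edges N))" and "0 \<le> t" "t < 1" "p \<in> didx N"
  shows "t * Dmap N z p < Dmap N (\<lambda>p \<in> zidx N (edges N). t * z p) p"
proof -
  obtain i f where p: "p = (i, f)" by fastforce
  have "restrict (\<lambda>p \<in> zidx N (edges N). t * z p) (zidx N (in_edges N i)) =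
      (\<lambda>p \<in> zidx N (in_edges N i). t * restrict z (zidx N (in_edges N i)) p)"
    using in_edges_subset[of i] by (auto simp: restrict_def fun_eq_iff)
  then show ?thesis
    using jitter_subhomogeneous[OF _ nnvec_restrict[OF z in_edges_subset]] assms
    by (auto simp: p Dmap_eq)
qed

section \<open>The map \<open>Ymap\<close>\<close>

lemma preds_didx: "carries N l f \<Longrightarrow> u \<in> preds N f l \<Longrightarrow> (u, f) \<in> didx N"
  by (auto simp: preds_def didx_def carries_def)

lemma Ymap_mono:
  assumes "(l, f) \<in> zidx N (edges N)" "\<And>p. p \<in> didx N \<Longrightarrow> d p \<le> e p"
  shows "Ymap N d (l, f) \<le> Ymap N e (l, f)"
proof -
  have c: "carries N l f" "f \<in> flows N" using assms(1) by (auto simp: zidx_iff carries_def)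
  have "(\<Sum>u \<in> preds N f l. d (u, f)) \<le> (\<Sum>u \<in> preds N f l. e (u, f))"
    using assms(2) preds_didx[OF c(1)] by (intro sum_mono) blast
  then show ?thesis using assms(1) rate_pos[OF c(2)] by (simp add: Ymap_def)
qed

lemma Ymap_pos:
  assumes "(l, f) \<in> zidx N (edges N)" "d \<in> nnvec (didx N)"
  shows "0 < Ymap N d (l, f)"
proof -
  have c: "carries N l f" "f \<in> flows N" using assms(1) by (auto simp: zidx_iff carries_def)
  have "0 \<le> (\<Sum>u \<in> preds N f l. d (u, f))"
    using preds_didx[OF c(1)] assms(2) by (auto intro!: sum_nonneg simp: nnvec_nonneg)
  then have "0 \<le> rate N f * (\<Sum>u \<in> preds N f l. d (u, f))"
    using rate_pos[OF c(2)] by simp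
  then show ?thesis using assms(1) burst_pos[OF c(2)] by (simp add: Ymap_def)
qed

lemma Ymap_nnvec:
  assumes "d \<in> nnvec (didx N)"
  shows "Ymap N d \<in> nnvec (zidx N (edges N))"
proof -
  have "Ymap N d \<in> extensional (zidx N (edges N))" by (simp add: Ymap_def)
  then show ?thesis using Ymap_pos[OF _ assms] by (auto simp: nnvec_def PiE_def intro: less_imp_le)
qed

section \<open>The composition of \<open>Ymap\<close> with \<open>Dmap\<close>, and the fixpoint of
  \<open>Gmap\<close>\<close>

lemma YD_nnvec: "z \<in> nnvec (zidx N (edges N)) \<Longrightarrow> Ymap N (Dmap N z) \<in> nnvec (zidx N (edges N))"
  by (simp add: Ymap_nnvec Dmap_nnvec)

lemma YD_mono: "mono_on (nnvec (zidx N (edges N))) (\<lambda>z. Ymap N (Dmap N z))"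
proof (rule mono_onI)
  fix z w assume zw: "z \<in> nnvec (zidx N (edges N))" "w \<in> nnvec (zidx N (edges N))" "z \<le> w"
  then have "Dmap N z p \<le> Dmap N w p" if "p \<in> didx N" for p
    using that by (cases p) (auto intro!: Dmap_mono simp: le_fun_def)
  then show "Ymap N (Dmap N z) \<le> Ymap N (Dmap N w)"
    unfolding nnvec_le_iff[OF YD_nnvec[OF zw(1)] YD_nnvec[OF zw(2)]]
    by (auto intro: Ymap_mono)
qed

lemma YD_subhomogeneous:
  assumes z: "z \<in> nnvec (zidx N (edges N))" and t: "0 \<le> t" "t < 1" and p: "p \<in> zidx N (edges N)"
  shows "t * Ymap N (Dmap N z) p < Ymap N (Dmap N (\<lambda>p \<in> zidx N (edges N). t * z p)) p"
proof -
  obtain l f where lf: "p = (l, f)" by fastforce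
  have c: "carries N l f" "f \<in> flows N" using p lf by (auto simp: zidx_iff carries_def)
  \<comment> \<open>The delay terms on both sides coincide; strictness comes from
    \<open>t * burst N f < burst N f\<close>.\<close>
  have "t * Ymap N (Dmap N z) p < Ymap N (\<lambda>q. t * Dmap N z q) p"
    using p t burst_pos[OF c(2)]
    by (simp add: lf Ymap_def algebra_simps flip: sum_distrib_left)
  also have "\<dots> \<le> Ymap N (Dmap N (\<lambda>p \<in> zidx N (edges N). t * z p)) p"
    unfolding lf using p lf Dmap_subhomogeneous[OF z t] by (intro Ymap_mono) (auto intro: less_imp_le)
  finally show ?thesis .
qed

text \<open>Eliminating the delays leaves a fixpoint problem for \<open>Ymap\<close> after
  \<open>Dmap\<close>, to which the abstract results apply.\<close>

lemma Gmap_fixpoint_iff: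
  "(z, d) \<in> Gdom N \<and> Gmap N (z, d) = (z, d) \<longleftrightarrow>
   z \<in> nnvec (zidx N (edges N)) \<and> Ymap N (Dmap N z) = z \<and> d = Dmap N z"
  using Dmap_nnvec by (auto simp: Gdom_def Gmap_def)

lemma Gmap_fixpoint_ex1:
  assumes "pair_bounded (zidx N (edges N)) (didx N) (Low (Gdom N) (Gmap N))"
  shows "\<exists>!p. p \<in> Gdom N \<and> Gmap N p = p"
proof -
  let ?X = "nnvec (zidx N (edges N))" and ?H = "\<lambda>z. Ymap N (Dmap N z)"
  \<comment> \<open>Paired with its own delays, a postfixed point of the composition becomes one of
    \<open>Gmap\<close>, so boundedness is inherited.\<close>
  have "z \<in> fst ` Low (Gdom N) (Gmap N)" if "z \<in> Low ?X ?H" for z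
  proof -
    have "(z, Dmap N z) \<in> Low (Gdom N) (Gmap N)"
      using that Dmap_nnvec by (auto simp: Low_def Gdom_def Gmap_def)
    then show ?thesis by force
  qed
  then have "vec_bounded (zidx N (edges N)) (Low ?X ?H)"
    using assms unfolding pair_bounded_def vec_bounded_def by blast
  then obtain z where z: "z \<in> ?X" "?H z = z"
    using bounded_Low_fixpoint[of _ ?H, OF YD_nnvec YD_mono] by blast
  have uniq: "w = z" if w: "w \<in> ?X" "?H w = w" for w
  proof (rule antisym)
    note le = subhomogeneous_fixpoint_le[where H = ?H, OF finite_zidx YD_mono YD_subhomogeneous]
    show "w \<le> z" by (rule le) (use z w in auto)
    show "z \<le> w" by (rule le) (use z w in auto)
  qed
  show ?thesis
  proof (rule ex1I)
    show "(z, Dmap N z) \<in> Gdom N \<and> Gmap N (z, Dmap N z) = (z, Dmap N z)"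
      using z by (simp add: Gmap_fixpoint_iff)
    show "p = (z, Dmap N z)" if "p \<in> Gdom N \<and> Gmap N p = p" for p
      using that uniq by (cases p) (auto simp: Gmap_fixpoint_iff)
  qed
qed

section \<open>The FPTFA pass\<close>

text \<open>\<open>S\<close> is the set of nodes already treated.\<close>

definition pass_inv where
  "pass_inv L zL S = (\<lambda>(z, z', d).
     z \<in> nnvec (zidx N (L \<union> {l \<in> edges N. fst l \<in> S})) \<and>
     (\<forall>p \<in> zidx N L. z p = zL p) \<and>
     z' \<in> nnvec (zidx N (L \<inter> {l. fst l \<in> S})) \<and>
     d \<in> nnvec {(i, f) \<in> didx N. i \<in> S} \<and>
     (\<forall>i \<in> S. in_edges N i \<subseteq> L \<union> {l \<in> edges N. fst l \<in> S}) \<and>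
     (\<forall>i f. (i, f) \<in> didx N \<and> i \<in> S \<longrightarrow>
        d (i, f) = jitter N i (restrict z (zidx N (in_edges N i))) f) \<and>
     (\<forall>l f. carries N l f \<and> fst l \<in> S \<longrightarrow>
        (if l \<in> L then z' (l, f) else z (l, f)) = upstream N z l f + rate N f * d (fst l, f)))"

text \<open>A step writes only at edges leaving \<open>v\<close>, and to \<open>z\<close> only off
  the cut. All entries read so far, or by \<open>v\<close> itself, belong to \<open>L\<close> or
  leave a node of \<open>S\<close>; so earlier equations survive and the new ones hold by
  construction.\<close>

lemma pass_inv_step:
  assumes L: "L \<subseteq> edges N" and v: "v \<notin> S"
    and in_v: "in_edges N v \<subseteq> L \<union> {l \<in> edges N. fst l \<in> S}"
    and inv: "pass_inv L zL S (z, z', d)"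
  shows "pass_inv L zL (insert v S) (fptfa_step N L v (z, z', d))"
proof -
  let ?A = "L \<union> {l \<in> edges N. fst l \<in> S}"
  define x where "x = restrict z (zidx N (in_edges N v))"
  define y where "y = Zmap N v (jitter N v x) x"
  define z1 where "z1 = override_on z y (zidx N (out_edges N v - L))"
  define z1' where "z1' = override_on z' y (zidx N (out_edges N v \<inter> L))"
  define d1 where "d1 = override_on d (\<lambda>(j, f). jitter N v x f) {(j, f) \<in> didx N. j = v}"
  have step: "fptfa_step N L v (z, z', d) = (z1, z1', d1)"
    by (simp add: fptfa_step_def Let_def x_def y_def z1_def z1'_def d1_def)
  have z: "z \<in> nnvec (zidx N ?A)" and zL: "\<And>p. p \<in> zidx N L \<Longrightarrow> z p = zL p"
    and z': "z' \<in> nnvec (zidx N (L \<inter> {l. fst l \<in> S}))"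
    and d: "d \<in> nnvec {(i, f) \<in> didx N. i \<in> S}"
    and in_S: "\<And>i. i \<in> S \<Longrightarrow> in_edges N i \<subseteq> ?A"
    and dS: "\<And>i f. (i, f) \<in> didx N \<Longrightarrow> i \<in> S \<Longrightarrow>
        d (i, f) = jitter N i (restrict z (zidx N (in_edges N i))) f"
    and out: "\<And>l f. carries N l f \<Longrightarrow> fst l \<in> S \<Longrightarrow>
        (if l \<in> L then z' (l, f) else z (l, f)) = upstream N z l f + rate N f * d (fst l, f)"
    using inv unfolding pass_inv_def prod.case by blast+
  \<comment> \<open>The overwritten entries are off \<open>L\<close> and leave \<open>v\<close>,
    which is not in \<open>S\<close>.\<close>
  have same: "z1 (l, f) = z (l, f)" if "l \<in> ?A" for l f
    using that v by (auto simp: z1_def override_on_def zidx_def out_edges_def)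
  have in_i: "in_edges N i \<subseteq> ?A" if "i \<in> insert v S" for i using that in_S in_v by auto
  have same_in: "restrict z1 (zidx N (in_edges N i)) = restrict z (zidx N (in_edges N i))"
    if "i \<in> insert v S" for i
    using in_i[OF that] same by (auto simp: fun_eq_iff restrict_def zidx_def)
  have same_up: "upstream N z1 l f = upstream N z l f" if "carries N l f" "fst l \<in> insert v S" for l f
    using entry_edge_carries(1)[OF that(1)] subsetD[OF in_i[OF that(2)], THEN same]
    by (simp add: upstream_def)
  have x: "x \<in> nnvec (zidx N (in_edges N v))"
    unfolding x_def using z zidx_mono[OF in_v] by (rule nnvec_restrict)
  have d1_v: "d1 (v, f) = jitter N v x f" if "(v, f) \<in> didx N" for f
    using that by (simp add: d1_def override_on_def)
  have d1_S: "d1 (i, f) = d (i, f)" if "i \<in> S" for i f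
    using that v by (auto simp: d1_def override_on_def)
  have y: "y (l, f) = upstream N z l f + rate N f * jitter N v x f"
    if "carries N l f" "fst l = v" for l f
    using that entry_edge_carries[OF that(1)]
    by (auto simp: y_def Zmap_def zidx_def out_edges_def carries_edge upstream_def x_def)
  have y_nonneg: "0 \<le> y (l, f)" if "carries N l f" "fst l = v" for l f
  proof -
    have f: "f \<in> flows N" using that by (simp add: carries_def)
    have "0 \<le> upstream N z l f"
    proof (cases "fresh N f (fst l)")
      case True
      then show ?thesis using burst_pos[OF f] by (simp add: upstream_def)
    next
      case False
      then have "(entry_edge N f (fst l), f) \<in> zidx N ?A"
        using entry_edge_carries[OF that(1)] subsetD[OF in_v] that(2) by (simp add: zidx_iff)
      then show ?thesis using nnvec_nonneg[OF z] False by (simp add: upstream_def)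
    qed
    moreover have "0 \<le> jitter N v x f"
      using jitter_pos[OF _ x] carries_didx[OF that(1)] that(2) by (auto intro: less_imp_le)
    ultimately show ?thesis using y[OF that] rate_pos[OF f] by simp
  qed
  show ?thesis unfolding step pass_inv_def prod.case
  proof (intro conjI allI ballI impI; (elim conjE)?)
    show "z1 \<in> nnvec (zidx N (L \<union> {l \<in> edges N. fst l \<in> insert v S}))"
      using z y_nonneg unfolding nnvec_def PiE_iff extensional_def z1_def override_on_def
      by (auto simp: zidx_def out_edges_def)
    show "z1' \<in> nnvec (zidx N (L \<inter> {l. fst l \<in> insert v S}))"
      using z' y_nonneg L unfolding nnvec_def PiE_iff extensional_def z1'_def override_on_def
      by (auto simp: zidx_def out_edges_def)
    show "d1 \<in> nnvec {(i, f) \<in> didx N. i \<in> insert v S}"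
      using d jitter_pos[OF _ x, THEN less_imp_le]
      unfolding nnvec_def PiE_iff extensional_def d1_def override_on_def
      by auto
    show "z1 p = zL p" if "p \<in> zidx N L" for p
      using that zL same by (cases p) (auto simp: zidx_def)
    show "in_edges N i \<subseteq> L \<union> {l \<in> edges N. fst l \<in> insert v S}" if "i \<in> insert v S" for i
      using in_i[OF that] by auto
    show "d1 (i, f) = jitter N i (restrict z1 (zidx N (in_edges N i))) f"
      if "(i, f) \<in> didx N" "i \<in> insert v S" for i f
      using that same_in[OF that(2)] d1_v d1_S dS by (auto simp: x_def)
    show "(if l \<in> L then z1' (l, f) else z1 (l, f)) = upstream N z1 l f + rate N f * d1 (fst l, f)"
      if c: "carries N l f" and i: "fst l \<in> insert v S" for l f
    proof (cases "fst l = v")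
      case True
      then have "(if l \<in> L then z1' (l, f) else z1 (l, f)) = y (l, f)"
        using c by (auto simp: z1_def z1'_def override_on_def zidx_def out_edges_def carries_edge)
      then show ?thesis using True same_up[OF c i] y[OF c] d1_v carries_didx[OF c] by simp
    next
      case False
      then have "z1' (l, f) = z' (l, f)"
        by (auto simp: z1'_def override_on_def zidx_def out_edges_def)
      then show ?thesis
        using False i same_up[OF c i] out[OF c] d1_S same[of l f] c by (auto simp: carries_edge)
    qed
  qed
qed

lemma pass_inv_fold:
  assumes L: "L \<subseteq> edges N" and zL: "zL \<in> nnvec (zidx N L)" and "distinct xs"
    and "\<And>k. k < length xs \<Longrightarrow> in_edges N (xs ! k) \<subseteq> L \<union> (\<Union>m<k. out_edges N (xs ! m))"
  shows "pass_inv L zL (set xs) (fold (fptfa_step N L) xs (zL, \<lambda>_. undefined, \<lambda>_. undefined))"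
  using assms(3,4)
\<comment> \<open>The invariant concerns a processed prefix, so the list grows at its end.\<close>
proof (induction xs rule: rev_induct)
  case Nil
  \<comment> \<open>Initially \<open>z\<close> is the input, and the all-\<open>undefined\<close>
    functions are the vectors with empty index set.\<close>
  then show ?case using zL by (auto simp: pass_inv_def nnvec_def PiE_def zidx_def)
next
  case (snoc v xs)
  have "in_edges N (xs ! k) \<subseteq> L \<union> (\<Union>m<k. out_edges N (xs ! m))" if "k < length xs" for k
    using snoc.prems(2)[of k] that by (simp add: nth_append)
  then have IH: "pass_inv L zL (set xs)
      (fold (fptfa_step N L) xs (zL, \<lambda>_. undefined, \<lambda>_. undefined))"
    using snoc by simp
  have "in_edges N v \<subseteq> L \<union> (\<Union>m<length xs. out_edges N (xs ! m))"
    using snoc.prems(2)[of "length xs"] by (simp add: nth_append)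
  then have "in_edges N v \<subseteq> L \<union> {l \<in> edges N. fst l \<in> set xs}"
    by (force simp: out_edges_def)
  then show ?case
    using pass_inv_step[OF L] IH snoc.prems(1)
    by (cases "fold (fptfa_step N L) xs (zL, \<lambda>_. undefined, \<lambda>_. undefined)") auto
qed

text \<open>The invariant once all nodes are treated; later proofs know the pass only through it. On
  the cut, \<open>z\<close> keeps the input and \<open>Fmap\<close> records the output; off the cut,
  the output is written into \<open>z\<close> itself.\<close>

lemma pass_equations:
  assumes "is_cut N L" "fptfa_order N L vs" "zL \<in> nnvec (zidx N L)"
  obtains z where "z \<in> nnvec (zidx N (edges N))" "\<And>p. p \<in> zidx N L \<Longrightarrow> z p = zL p"
    "Fmap N L vs zL \<in> nnvec (zidx N L)" "fptfa_delays N L vs zL = Dmap N z"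
    "\<And>l f. carries N l f \<Longrightarrow> (if l \<in> L then Fmap N L vs zL (l, f) else z (l, f)) =
       upstream N z l f + rate N f * Dmap N z (fst l, f)"
proof -
  obtain z z' d where pass: "fptfa_pass N L vs zL = (z, z', d)" by (metis prod_cases3)
  have L: "L \<subseteq> edges N" using assms(1) by (simp add: is_cut_def)
  have vs: "distinct vs" "set vs = nodes N"
    "\<And>k. k < length vs \<Longrightarrow> in_edges N (vs ! k) \<subseteq> L \<union> (\<Union>m<k. out_edges N (vs ! m))"
    using assms(2) by (auto simp: fptfa_order_def)
  have inv: "pass_inv L zL (nodes N) (z, z', d)"
    using pass_inv_fold[OF L assms(3) vs(1,3)] pass vs(2) by (simp add: fptfa_pass_def)
  have didx: "i \<in> nodes N" if "(i, f) \<in> didx N" for i f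
    using that route_nodes by (auto simp: didx_def)
  have sets: "zidx N (L \<union> {l \<in> edges N. fst l \<in> nodes N}) = zidx N (edges N)"
    "zidx N (L \<inter> {l. fst l \<in> nodes N}) = zidx N L" "{(i, f) \<in> didx N. i \<in> nodes N} = didx N"
    using L carries_node didx by (auto simp: zidx_def)
  have *: "z \<in> nnvec (zidx N (edges N))" "\<And>p. p \<in> zidx N L \<Longrightarrow> z p = zL p"
    "z' \<in> nnvec (zidx N L)" "d \<in> nnvec (didx N)"
    "\<And>i f. (i, f) \<in> didx N \<Longrightarrow> d (i, f) = jitter N i (restrict z (zidx N (in_edges N i))) f"
    "\<And>l f. carries N l f \<Longrightarrow> (if l \<in> L then z' (l, f) else z (l, f)) =
       upstream N z l f + rate N f * d (fst l, f)"
    using inv didx carries_node unfolding pass_inv_def prod.case sets by blast+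
  have "d = Dmap N z"
    using *(4,5) Dmap_nnvec[OF *(1)] by (intro antisym) (auto simp: nnvec_le_iff Dmap_eq)
  moreover have "Fmap N L vs zL = z'" "fptfa_delays N L vs zL = d"
    by (simp_all add: Fmap_def fptfa_delays_def pass)
  ultimately show ?thesis using * by (intro that[of z]) blast+
qed

text \<open>Induction on the position of the tail in \<open>vs\<close>: edges entering that node are
  in the cut, where the order is assumed, or leave earlier nodes. Unlike in
  \<open>upstream_compare\<close>, each vector has its own delays. Used in both directions, this
  shows that the pass equations determine \<open>z\<close>.\<close>

lemma pass_compare:
  assumes order: "fptfa_order N L vs"
    and z: "z \<in> nnvec (zidx N (edges N))" and w: "w \<in> nnvec (zidx N (edges N))"
    and zwL: "\<And>p. p \<in> zidx N L \<Longrightarrow> z p \<le> w p"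
    and sub: "\<And>l f. carries N l f \<Longrightarrow> l \<notin> L \<Longrightarrow>
      z (l, f) \<le> upstream N z l f + rate N f * Dmap N z (fst l, f)"
    and super: "\<And>l f. carries N l f \<Longrightarrow> l \<notin> L \<Longrightarrow>
      upstream N w l f + rate N f * Dmap N w (fst l, f) \<le> w (l, f)"
    and p: "p \<in> zidx N (edges N)"
  shows "z p \<le> w p"
proof -
  have vs: "set vs = nodes N"
    "\<And>k. k < length vs \<Longrightarrow> in_edges N (vs ! k) \<subseteq> L \<union> (\<Union>m<k. out_edges N (vs ! m))"
    using order by (auto simp: fptfa_order_def)
  have *: "z (l, f) \<le> w (l, f)" if "k < length vs" "carries N l f" "fst l = vs ! k" for k l f
    using that
  proof (induction k arbitrary: l f rule: less_induct)
    case (less k)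
    have le_in: "z (l', f') \<le> w (l', f')" if "l' \<in> in_edges N (fst l)" "carries N l' f'" for l' f'
    proof -
      have "l' \<in> L \<union> (\<Union>m<k. out_edges N (vs ! m))" using that less.prems vs(2)[of k] by auto
      then show ?thesis
        using less.IH[of _ l' f'] less.prems(1) that(2) zwL[of "(l', f')"]
        by (auto simp: out_edges_def zidx_iff)
    qed
    have "upstream N z l f \<le> upstream N w l f"
      using le_in entry_edge_carries[OF less.prems(2)] by (auto simp: upstream_def)
    moreover have "Dmap N z (fst l, f) \<le> Dmap N w (fst l, f)"
      using le_in carries_didx[OF less.prems(2)] by (intro Dmap_mono z w) (auto simp: zidx_def)
    then have "rate N f * Dmap N z (fst l, f) \<le> rate N f * Dmap N w (fst l, f)"
      using rate_pos less.prems(2) by (auto simp: carries_def)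
    moreover have "z (l, f) \<le> w (l, f)" if "l \<in> L" using zwL that less.prems(2) by (auto simp: zidx_def)
    ultimately show ?case using sub[OF less.prems(2)] super[OF less.prems(2)] by fastforce
  qed
  obtain l f where lf: "p = (l, f)" by fastforce
  then have c: "carries N l f" using p by (simp add: zidx_iff)
  then have "fst l \<in> set vs" using carries_node vs(1) by simp
  then obtain k where "k < length vs" "fst l = vs ! k" by (auto simp: in_set_conv_nth)
  then show ?thesis using *[OF _ c] lf by simp
qed

section \<open>Comparing \<open>\<F>\<^sup>L\<close> and \<open>\<G>\<close>\<close>

text \<open>On the cut the pass vector is \<open>zL\<close>, which lies below the output, so it is a
  subsolution of the output recursion on every edge. With delays \<open>Dmap N z\<close>, comparison
  along routes puts it below \<open>Ymap N (Dmap N z)\<close>.\<close>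

lemma Low_Fmap_imp_Low_Gmap:
  assumes cut: "is_cut N L" and order: "fptfa_order N L vs"
    and zL: "zL \<in> Low (nnvec (zidx N L)) (Fmap N L vs)"
  shows "\<exists>z. (z, Dmap N z) \<in> Low (Gdom N) (Gmap N) \<and> (\<forall>p \<in> zidx N L. z p = zL p)"
proof -
  have zL': "zL \<in> nnvec (zidx N L)" "zL \<le> Fmap N L vs zL" using zL by (auto simp: Low_def)
  obtain z where z: "z \<in> nnvec (zidx N (edges N))" "\<And>p. p \<in> zidx N L \<Longrightarrow> z p = zL p"
    "Fmap N L vs zL \<in> nnvec (zidx N L)" "fptfa_delays N L vs zL = Dmap N z"
    "\<And>l f. carries N l f \<Longrightarrow> (if l \<in> L then Fmap N L vs zL (l, f) else z (l, f)) =
       upstream N z l f + rate N f * Dmap N z (fst l, f)"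
    by (rule pass_equations[OF cut order zL'(1)]) blast
  have *: "z (l, f) \<le> upstream N z l f + rate N f * Dmap N z (fst l, f)" if "carries N l f" for l f
    using z(2)[of "(l, f)"] z(5)[OF that] le_funD[OF zL'(2), of "(l, f)"] that
    by (auto simp: zidx_iff split: if_splits)
  have "z (l, f) \<le> Ymap N (Dmap N z) (l, f)" if "carries N l f" for l f
    by (rule upstream_compare[where d = "Dmap N z", OF that]) (simp_all add: * Ymap_upstream)
  then have "z \<le> Ymap N (Dmap N z)"
    using z(1) YD_nnvec by (auto simp: nnvec_le_iff zidx_iff)
  then have "(z, Dmap N z) \<in> Low (Gdom N) (Gmap N)"
    using z(1) Dmap_nnvec by (simp add: Low_def Gdom_def Gmap_def)
  then show ?thesis using z(2) by blast
qed

text \<open>\<open>z\<close> itself need not be a subsolution of the output recursion, as its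
  upstream entries may be too small. The larger \<open>Ymap N d\<close> solves the recursion for
  \<open>d\<close>, and \<open>d \<le> Dmap N z \<le> Dmap N (Ymap N d)\<close>.\<close>

lemma Low_Gmap_subsolution:
  assumes zd: "(z, d) \<in> Low (Gdom N) (Gmap N)"
  shows "Ymap N d \<in> nnvec (zidx N (edges N))" "z \<le> Ymap N d"
    and "\<And>i f. (i, f) \<in> didx N \<Longrightarrow> d (i, f) \<le> Dmap N (Ymap N d) (i, f)"
    and "\<And>l f. carries N l f \<Longrightarrow> Ymap N d (l, f) \<le>
      upstream N (Ymap N d) l f + rate N f * Dmap N (Ymap N d) (fst l, f)"
proof -
  have zd': "z \<in> nnvec (zidx N (edges N))" "d \<in> nnvec (didx N)" "d \<le> Dmap N z"
    using zd by (auto simp: Low_def Gdom_def Gmap_def)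
  show y: "Ymap N d \<in> nnvec (zidx N (edges N))" using zd'(2) by (rule Ymap_nnvec)
  show zy: "z \<le> Ymap N d" using zd by (auto simp: Low_def Gmap_def)
  show d_le: "d (i, f) \<le> Dmap N (Ymap N d) (i, f)" if "(i, f) \<in> didx N" for i f
    using le_funD[OF zd'(3), of "(i, f)"] Dmap_mono[OF zd'(1) y that] le_funD[OF zy]
    by fastforce
  show "Ymap N d (l, f) \<le>
      upstream N (Ymap N d) l f + rate N f * Dmap N (Ymap N d) (fst l, f)"
    if "carries N l f" for l f
    using Ymap_upstream[OF that, of d] d_le[OF carries_didx[OF that]] rate_pos[of f] that
    by (simp add: carries_def)
qed

text \<open>Fed with the cut part of \<open>Ymap N d\<close>, the pass computes a vector
  \<open>w\<close> above \<open>Ymap N d\<close>. Its outputs on the cut come from larger upstream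
  values and delays, so they dominate the input.\<close>

lemma Low_Gmap_imp_Low_Fmap:
  assumes cut: "is_cut N L" and order: "fptfa_order N L vs"
    and zd: "(z, d) \<in> Low (Gdom N) (Gmap N)"
  shows "restrict (Ymap N d) (zidx N L) \<in> Low (nnvec (zidx N L)) (Fmap N L vs)"
proof -
  let ?y = "Ymap N d" and ?yL = "restrict (Ymap N d) (zidx N L)"
  have L: "zidx N L \<subseteq> zidx N (edges N)" using cut by (auto simp: is_cut_def zidx_def)
  note y = Low_Gmap_subsolution(1)[OF zd] and y_le = Low_Gmap_subsolution(4)[OF zd]
  have yL: "?yL \<in> nnvec (zidx N L)" using y L by (rule nnvec_restrict)
  obtain w where w: "w \<in> nnvec (zidx N (edges N))" "\<And>p. p \<in> zidx N L \<Longrightarrow> w p = ?yL p"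
    "Fmap N L vs ?yL \<in> nnvec (zidx N L)"
    "fptfa_delays N L vs ?yL = Dmap N w"
    "\<And>l f. carries N l f \<Longrightarrow> (if l \<in> L then Fmap N L vs ?yL (l, f) else w (l, f)) =
       upstream N w l f + rate N f * Dmap N w (fst l, f)"
    by (rule pass_equations[OF cut order yL]) blast
  \<comment> \<open>The two agree on the cut; off it, \<open>?y\<close> is a subsolution and
    \<open>w\<close> an exact solution.\<close>
  have y_w: "?y p \<le> w p" if "p \<in> zidx N (edges N)" for p
  proof (rule pass_compare[OF order y w(1) _ _ _ that])
    show "?y p \<le> w p" if "p \<in> zidx N L" for p using w(2) that by simp
    show "upstream N w l f + rate N f * Dmap N w (fst l, f) \<le> w (l, f)"
      if "carries N l f" "l \<notin> L" for l f using w(5)[OF that(1)] that(2) by simp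
  qed (use y_le in blast)
  have "?yL (l, f) \<le> Fmap N L vs ?yL (l, f)" if "(l, f) \<in> zidx N L" for l f
  proof -
    have c: "carries N l f" "l \<in> L" using that by (auto simp: zidx_iff)
    have "upstream N ?y l f \<le> upstream N w l f"
      using upstream_mono[OF c(1) y_w] .
    moreover have "Dmap N ?y (fst l, f) \<le> Dmap N w (fst l, f)"
      using y_w[OF subsetD[OF in_edges_subset]] carries_didx[OF c(1)]
      by (intro Dmap_mono y w(1)) simp_all
    then have "rate N f * Dmap N ?y (fst l, f) \<le> rate N f * Dmap N w (fst l, f)"
      using rate_pos c(1) by (auto simp: carries_def)
    ultimately show ?thesis using y_le[OF c(1)] w(5)[OF c(1)] c that by simp
  qed
  then have "?yL \<le> Fmap N L vs ?yL" by (subst nnvec_le_iff[OF yL w(3)]) auto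
  then show ?thesis using yL by (simp add: Low_def)
qed

text \<open>Every postfixed point of \<open>Fmap\<close> is the cut part of one of
  \<open>Gmap\<close>. Conversely, one pass from a constant input above all postfixed points of
  \<open>Fmap\<close> dominates every postfixed point of \<open>Gmap\<close>.\<close>

lemma bounded_Low_iff:
  assumes cut: "is_cut N L" and order: "fptfa_order N L vs"
  shows "pair_bounded (zidx N (edges N)) (didx N) (Low (Gdom N) (Gmap N)) \<longleftrightarrow>
    vec_bounded (zidx N L) (Low (nnvec (zidx N L)) (Fmap N L vs))" (is "?G \<longleftrightarrow> ?F")
proof
  have L: "zidx N L \<subseteq> zidx N (edges N)" using cut by (auto simp: is_cut_def zidx_def)
  assume ?G
  then obtain B where B: "\<And>z d p. (z, d) \<in> Low (Gdom N) (Gmap N) \<Longrightarrow> p \<in> zidx N (edges N) \<Longrightarrow> \<bar>z p\<bar> \<le> B"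
    unfolding pair_bounded_def vec_bounded_def by force
  have "\<bar>zL p\<bar> \<le> B" if "zL \<in> Low (nnvec (zidx N L)) (Fmap N L vs)" "p \<in> zidx N L" for zL p
    using Low_Fmap_imp_Low_Gmap[OF cut order that(1)] that(2) B L by fastforce
  then show ?F unfolding vec_bounded_def by blast
next
  have L: "zidx N L \<subseteq> zidx N (edges N)" using cut by (auto simp: is_cut_def zidx_def)
  assume ?F
  then obtain B where B: "\<And>zL p. zL \<in> Low (nnvec (zidx N L)) (Fmap N L vs) \<Longrightarrow> p \<in> zidx N L \<Longrightarrow> \<bar>zL p\<bar> \<le> B"
    unfolding vec_bounded_def by blast
  \<comment> \<open>The absolute value makes the input nonnegative whatever the sign of
    \<open>B\<close>.\<close>
  define zB where "zB = (\<lambda>p \<in> zidx N L. \<bar>B\<bar>)"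
  have "zB \<in> nnvec (zidx N L)" by (auto simp: zB_def nnvec_def)
  then obtain w where w: "w \<in> nnvec (zidx N (edges N))" "\<And>p. p \<in> zidx N L \<Longrightarrow> w p = zB p"
    "Fmap N L vs zB \<in> nnvec (zidx N L)" "fptfa_delays N L vs zB = Dmap N w"
    "\<And>l f. carries N l f \<Longrightarrow> (if l \<in> L then Fmap N L vs zB (l, f) else w (l, f)) =
       upstream N w l f + rate N f * Dmap N w (fst l, f)"
    by (rule pass_equations[OF cut order]) blast
  have y_w: "Ymap N d p \<le> w p"
    if zd: "(z, d) \<in> Low (Gdom N) (Gmap N)" and p: "p \<in> zidx N (edges N)" for z d p
  proof (rule pass_compare[OF order Low_Gmap_subsolution(1)[OF zd] w(1) _ _ _ p])
    show "Ymap N d p \<le> w p" if "p \<in> zidx N L" for p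
      using B[OF Low_Gmap_imp_Low_Fmap[OF cut order zd] that] w(2)[OF that] that by (simp add: zB_def)
    show "upstream N w l f + rate N f * Dmap N w (fst l, f) \<le> w (l, f)"
      if "carries N l f" "l \<notin> L" for l f using w(5)[OF that(1)] that(2) by simp
  qed (use Low_Gmap_subsolution(4)[OF zd] in blast)
  have z_w: "z p \<le> w p" if "(z, d) \<in> Low (Gdom N) (Gmap N)" "p \<in> zidx N (edges N)" for z d p
    using y_w[OF that] le_funD[OF Low_Gmap_subsolution(2)[OF that(1)]] order_trans by blast
  have d_w: "d p \<le> Dmap N w p" if zd: "(z, d) \<in> Low (Gdom N) (Gmap N)" and "p \<in> didx N" for z d p
  proof -
    obtain i f where p: "p = (i, f)" by fastforce
    have "Dmap N (Ymap N d) (i, f) \<le> Dmap N w (i, f)"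
      using y_w[OF zd subsetD[OF in_edges_subset]] that(2) p
      by (intro Dmap_mono Low_Gmap_subsolution(1)[OF zd] w(1)) simp_all
    then show ?thesis using Low_Gmap_subsolution(3)[OF zd, of i f] that(2) p by simp
  qed
  have "vec_bounded (zidx N (edges N)) (fst ` Low (Gdom N) (Gmap N))"
  proof (rule vec_bounded_upper[OF finite_zidx])
    show "fst ` Low (Gdom N) (Gmap N) \<subseteq> nnvec (zidx N (edges N))" by (auto simp: Low_def Gdom_def)
    show "z p \<le> w p" if "z \<in> fst ` Low (Gdom N) (Gmap N)" "p \<in> zidx N (edges N)" for z p
      using that(1) z_w[OF _ that(2)] by force
  qed
  moreover have "vec_bounded (didx N) (snd ` Low (Gdom N) (Gmap N))"
  proof (rule vec_bounded_upper[OF finite_didx])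
    show "snd ` Low (Gdom N) (Gmap N) \<subseteq> nnvec (didx N)" by (auto simp: Low_def Gdom_def)
    show "d p \<le> Dmap N w p" if "d \<in> snd ` Low (Gdom N) (Gmap N)" "p \<in> didx N" for d p
      using that(1) d_w[OF _ that(2)] by force
  qed
  ultimately show ?G by (simp add: pair_bounded_def)
qed

text \<open>At a fixpoint the output on the cut equals the input, so the recursion holds as an
  equation on every edge. Comparison along routes in both directions gives
  \<open>z = Ymap N (Dmap N z)\<close>.\<close>

lemma Fmap_fixpoint_imp_Gmap_fixpoint:
  assumes cut: "is_cut N L" and order: "fptfa_order N L vs"
    and zL: "zL \<in> nnvec (zidx N L)" "Fmap N L vs zL = zL"
  shows "\<exists>z. (z, fptfa_delays N L vs zL) \<in> Gdom N \<and>
    Gmap N (z, fptfa_delays N L vs zL) = (z, fptfa_delays N L vs zL) \<and> restrict z (zidx N L) = zL"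
proof -
  obtain z where z: "z \<in> nnvec (zidx N (edges N))" "\<And>p. p \<in> zidx N L \<Longrightarrow> z p = zL p"
    "Fmap N L vs zL \<in> nnvec (zidx N L)" "fptfa_delays N L vs zL = Dmap N z"
    "\<And>l f. carries N l f \<Longrightarrow> (if l \<in> L then Fmap N L vs zL (l, f) else z (l, f)) =
       upstream N z l f + rate N f * Dmap N z (fst l, f)"
    by (rule pass_equations[OF cut order zL(1)]) blast
  have eq: "z (l, f) = upstream N z l f + rate N f * Dmap N z (fst l, f)" if "carries N l f" for l f
    using z(5)[OF that] z(2)[of "(l, f)"] that by (auto simp: zidx_iff zL(2) split: if_splits)
  have "z (l, f) = Ymap N (Dmap N z) (l, f)" if "carries N l f" for l f
  proof (rule antisym)
    show "z (l, f) \<le> Ymap N (Dmap N z) (l, f)"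
      by (rule upstream_compare[where d = "Dmap N z", OF that]) (simp_all add: eq[symmetric] Ymap_upstream)
    show "Ymap N (Dmap N z) (l, f) \<le> z (l, f)"
      by (rule upstream_compare[where d = "Dmap N z", OF that]) (simp_all add: eq[symmetric] Ymap_upstream)
  qed
  then have "Ymap N (Dmap N z) = z"
    using z(1) YD_nnvec[OF z(1)] by (intro antisym) (auto simp: nnvec_le_iff zidx_iff)
  moreover have "restrict z (zidx N L) = zL"
    using z(2) zL(1) by (auto simp: nnvec_def PiE_def extensional_def fun_eq_iff restrict_def)
  ultimately show ?thesis using z(1,4) Gmap_fixpoint_iff by blast
qed

text \<open>A fixpoint of \<open>Gmap\<close> solves the output recursion on every edge, hence the
  pass equations with its cut part as input. These determine the vector, so the pass reproduces
  \<open>z\<close>, also in its outputs on the cut.\<close>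

lemma Gmap_fixpoint_imp_Fmap_fixpoint:
  assumes cut: "is_cut N L" and order: "fptfa_order N L vs"
    and zd: "(z, d) \<in> Gdom N" "Gmap N (z, d) = (z, d)"
  shows "restrict z (zidx N L) \<in> nnvec (zidx N L)"
    "Fmap N L vs (restrict z (zidx N L)) = restrict z (zidx N L)"
proof -
  let ?zL = "restrict z (zidx N L)"
  have z: "z \<in> nnvec (zidx N (edges N))" "Ymap N (Dmap N z) = z"
    using zd Gmap_fixpoint_iff by auto
  have eq: "z (l, f) = upstream N z l f + rate N f * Dmap N z (fst l, f)" if "carries N l f" for l f
    using Ymap_upstream[OF that, of "Dmap N z"] z(2) by simp
  have L: "zidx N L \<subseteq> zidx N (edges N)" using cut by (auto simp: is_cut_def zidx_def)
  show zL: "?zL \<in> nnvec (zidx N L)" using z(1) L by (rule nnvec_restrict)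
  obtain w where w: "w \<in> nnvec (zidx N (edges N))" "\<And>p. p \<in> zidx N L \<Longrightarrow> w p = ?zL p"
    "Fmap N L vs ?zL \<in> nnvec (zidx N L)"
    "fptfa_delays N L vs ?zL = Dmap N w"
    "\<And>l f. carries N l f \<Longrightarrow> (if l \<in> L then Fmap N L vs ?zL (l, f) else w (l, f)) =
       upstream N w l f + rate N f * Dmap N w (fst l, f)"
    by (rule pass_equations[OF cut order zL]) blast
  have weq: "w (l, f) = upstream N w l f + rate N f * Dmap N w (fst l, f)"
    if "carries N l f" "l \<notin> L" for l f using w(5)[OF that(1)] that(2) by simp
  have "z p \<le> w p" "w p \<le> z p" if "p \<in> zidx N (edges N)" for p
    using pass_compare[OF order z(1) w(1) _ _ _ that] pass_compare[OF order w(1) z(1) _ _ _ that]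
      w(2) eq weq by (simp_all add: order_eq_refl)
  then have "w = z" using z(1) w(1) by (intro antisym) (auto simp: nnvec_le_iff)
  then have "Fmap N L vs ?zL (l, f) = z (l, f)" if "(l, f) \<in> zidx N L" for l f
    using w(5)[of l f] eq[of l f] that by (auto simp: zidx_iff)
  then show "Fmap N L vs ?zL = ?zL"
    using w(3) zL by (intro antisym) (auto simp: nnvec_le_iff)
qed

end

theorem theorem3:
  fixes N :: "('v, 'f) net" and L :: "('v \<times> 'v) set" and vs :: "'v list"
  assumes "network N"
    and "is_cut N L"
    and "fptfa_order N L vs"
  shows
    "let bddG = pair_bounded (zidx N (edges N)) (didx N) (Low (Gdom N) (Gmap N));
         bddF = vec_bounded (zidx N L) (Low (nnvec (zidx N L)) (Fmap N L vs))
     in (bddG \<longleftrightarrow> bddF) \<and>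
        (bddG \<and> bddF \<longrightarrow>
          (\<exists>!p. p \<in> Gdom N \<and> Gmap N p = p) \<and>
          (\<exists>!z. z \<in> nnvec (zidx N L) \<and> Fmap N L vs z = z) \<and>
          (\<forall>zbar dbar zstar.
             (zbar, dbar) \<in> Gdom N \<and> Gmap N (zbar, dbar) = (zbar, dbar) \<and>
             zstar \<in> nnvec (zidx N L) \<and> Fmap N L vs zstar = zstar \<longrightarrow>
               restrict zbar (zidx N L) = zstar \<and> dbar = fptfa_delays N L vs zstar))"
  proof -
  interpret network N by (rule assms(1))
  note cut_order = assms(2,3)
  let ?G = "pair_bounded (zidx N (edges N)) (didx N) (Low (Gdom N) (Gmap N))"
  have ex1: "\<exists>!z. z \<in> nnvec (zidx N L) \<and> Fmap N L vs z = z"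
    and agree: "\<And>zbar dbar zstar. (zbar, dbar) \<in> Gdom N \<and> Gmap N (zbar, dbar) = (zbar, dbar) \<and>
        zstar \<in> nnvec (zidx N L) \<and> Fmap N L vs zstar = zstar \<Longrightarrow>
      restrict zbar (zidx N L) = zstar \<and> dbar = fptfa_delays N L vs zstar" if ?G
  proof -
    obtain zb db where zd: "(zb, db) \<in> Gdom N" "Gmap N (zb, db) = (zb, db)"
      and uniq: "\<And>z d. (z, d) \<in> Gdom N \<Longrightarrow> Gmap N (z, d) = (z, d) \<Longrightarrow> z = zb \<and> d = db"
      using Gmap_fixpoint_ex1[OF \<open>?G\<close>] by (metis prod.collapse prod.inject)
    \<comment> \<open>Each fixpoint of \<open>Fmap\<close> lifts to a fixpoint of
      \<open>Gmap\<close> with the delays of its pass, and the latter is unique. This gives both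
      uniqueness for \<open>Fmap\<close> and the agreement.\<close>
    have star: "restrict zb (zidx N L) = zL \<and> db = fptfa_delays N L vs zL"
      if "zL \<in> nnvec (zidx N L)" "Fmap N L vs zL = zL" for zL
      using Fmap_fixpoint_imp_Gmap_fixpoint[OF cut_order that] uniq by blast
    show "\<exists>!z. z \<in> nnvec (zidx N L) \<and> Fmap N L vs z = z"
      using Gmap_fixpoint_imp_Fmap_fixpoint[OF cut_order zd] star by blast
    show "restrict zbar (zidx N L) = zstar \<and> dbar = fptfa_delays N L vs zstar"
      if "(zbar, dbar) \<in> Gdom N \<and> Gmap N (zbar, dbar) = (zbar, dbar) \<and>
        zstar \<in> nnvec (zidx N L) \<and> Fmap N L vs zstar = zstar" for zbar dbar zstar
      using that uniq star by blast
  qed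
  show ?thesis
    unfolding Let_def bounded_Low_iff[OF cut_order, symmetric]
    using Gmap_fixpoint_ex1 ex1 agree by blast
qed

end
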